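(* Consider the lossy active power flow equations $$P_i = \sum_{j\neq i}B_{ij}V_iV_j\sin(\theta_i-\theta_j) + G_{ii}V_i^2 + \sum_{j\neq i}G_{ij}V_iV_j\cos(\theta_i-\theta_j),\qquad i\in\{1,\dots,n\},$$ with $\theta_{n+1}=0$, in the unknowns $\theta_r=(\theta_1,\dots,\theta_n)\in\mathbb{R}^n$. Assume the network is radial (a tree), there are no off-nominal tap ratios, and $V_i=V>0$ for all buses $i\in\{1,\dots,n+1\}$. Let $$\rho = \|\mathsf{D}_B^{-1}A_r^{-1}|A|_r\mathsf{D}_G\|_\infty,\qquad \psi_{\rm MDC}=A_r^{\mathsf T}\mathsf{L}_B^{-1}P_r,\qquad \Gamma=\|\psi_{\rm MDC}\|_\infty .$$ If $$\Gamma^2+2\Gamma\rho<1,$$ then the active power flow equations possess a unique solution $\theta_r^*=(\theta_1^*,\dots,\theta_n^* )$ with branch-wise phase differences $A_r^{\mathsf T}\theta_r^*\in\mathbb{R}^m$ satisfying $\|A_r^{\mathsf T}\theta_r^*\|_\infty\le\arcsin(\beta_-)<\frac{\pi}{2}$, where $$\beta_\pm = \frac{\Gamma+\rho}{1+\rho^2}\pm\frac{\rho}{1+\rho^2}\sqrt{1-(\Gamma^2+2\Gamma\rho)}$$ satisfy $0\le\beta_-<\beta_+\le1$. Moreover, there do not exist any solutions with phase differences satisfying $$\arcsin(\beta_-)<|\theta_i-\theta_j|<\arcsin(\beta_+)$$ for any branch $(i,j)\in\mathcal E$.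
   Context: Network: a connected graph $(\mathcal N,\mathcal E)$ with buses $\mathcal N=\{1,\dots,n+1\}$ and $m$ branches; bus $n+1$ is the slack bus with $\theta_{n+1}=0$. For a radial network the graph is a tree, $m=n$, and the reduced incidence matrix $A_r$ below is invertible. The injections $P_i\in\mathbb{R}$ ($i=1,\dots,n$) are fixed. The symmetric admittance matrix is $Y=G+\mathrm{j}B$ with $G,B$ real. Without off-nominal tap ratios, for a branch between $i$ and $j$ one has $Y_{ij}=-y_{ij}$, where the transfer admittance $y_{ij}$ has nonnegative real part and negative imaginary part, so $G_{ij}\le0$ and $B_{ij}>0$ on branches; $Y_{ij}=0$ if $i\neq j$ are not joined by a branch; and $G_{ii}=-\sum_{j\ne i}G_{ij}$. Each branch has an arbitrary orientation. The node-edge incidence matrix $A\in\mathbb{R}^{(n+1)\times m}$ has $A_{ke}=1$ if $k$ is the source of $e$, $-1$ if $k$ is the sink of $e$, and $0$ otherwise. $A_r\in\mathbb{R}^{n\times m}$ is $A$ with the row of the slack bus removed; $|A|_r$ is $A_r$ with every nonzero entry replaced by $1$. The components of $A_r^{\mathsf T}\theta_r$ are the phase differences $\theta_i-\theta_j$ over the branches $(i,j)$. $\mathsf{D}_B$ and $\mathsf{D}_G$ are the $m\times m$ diagonal matrices with entries $V_iV_jB_{ij}$ and $V_iV_j|G_{ij}|$, respectively, for the branch $(i,j)$; $\mathsf{L}_B=A_r\mathsf{D}_BA_r^{\mathsf T}$ (positive definite); $P_r=(P_1,\dots,P_n)^{\mathsf T}$. For vectors $\|x\|_\infty=\max_i|x_i|$,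 and for matrices $\|\cdot\|_\infty$ is the induced norm (maximum absolute row sum).
   Formalization: β₋<β₊ is proved when some branch has G_ij≠0 (else β₋=β₊). "No solutions … for any branch" fails for a single branch in the gap; proved instead: no solution has ‖A_rᵀθ_r‖_∞ strictly between arcsin β₋ and arcsin β₊, nor all branches in the gap. *)

theory Defs
  imports "HOL-Analysis.Analysis"
begin

text \<open>
  The buses are indexed by \<open>'n option\<close>: the non-slack buses \<open>1, ..., n\<close> are \<open>Some i\<close> with
  \<open>i :: 'n\<close>, and the slack bus \<open>n + 1\<close> is \<open>None\<close>. The branches are indexed by a finite type
  \<open>'e\<close>, so \<open>m = CARD('e)\<close>; their (arbitrary) orientation is given by \<open>src\<close> and \<open>snk\<close>.
\<close>

subsection \<open>Undirected graph underlying an oriented branch set\<close>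

definition adjacent :: "('e \<Rightarrow> 'b) \<Rightarrow> ('e \<Rightarrow> 'b) \<Rightarrow> 'b \<Rightarrow> 'b \<Rightarrow> bool" where
  "adjacent src snk i j \<longleftrightarrow> (\<exists>e. (src e = i \<and> snk e = j) \<or> (src e = j \<and> snk e = i))"

definition simple_network :: "('e \<Rightarrow> 'b) \<Rightarrow> ('e \<Rightarrow> 'b) \<Rightarrow> bool" where
  "simple_network src snk \<longleftrightarrow>
     (\<forall>e. src e \<noteq> snk e) \<and> (\<forall>e f. {src e, snk e} = {src f, snk f} \<longrightarrow> e = f)"

definition connected_network :: "('e \<Rightarrow> 'b) \<Rightarrow> ('e \<Rightarrow> 'b) \<Rightarrow> bool" where
  "connected_network src snk \<longleftrightarrow> (\<forall>i j. (adjacent src snk)\<^sup>*\<^sup>* i j)"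

definition network_cycle :: "('e \<Rightarrow> 'b) \<Rightarrow> ('e \<Rightarrow> 'b) \<Rightarrow> 'b list \<Rightarrow> bool" where
  "network_cycle src snk vs \<longleftrightarrow> 3 \<le> length vs \<and> distinct vs \<and>
     (\<forall>k < length vs. adjacent src snk (vs ! k) (vs ! (Suc k mod length vs)))"

definition radial_network :: "('e \<Rightarrow> 'b) \<Rightarrow> ('e \<Rightarrow> 'b) \<Rightarrow> bool" where
  "radial_network src snk \<longleftrightarrow> simple_network src snk \<and> connected_network src snk \<and>
     \<not> (\<exists>vs. network_cycle src snk vs)"

subsection \<open>Admittance matrix\<close>

definition conductance :: "complex ^ 'b ^ 'b \<Rightarrow> real ^ 'b ^ 'b" where
  "conductance Y = (\<chi> i j. Re (Y $ i $ j))"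

definition susceptance :: "complex ^ 'b ^ 'b \<Rightarrow> real ^ 'b ^ 'b" where
  "susceptance Y = (\<chi> i j. Im (Y $ i $ j))"

text \<open>
  On a branch the transfer admittance is \<open>- Y $ i $ j\<close>. The diagonal of the susceptance matrix is
  left free, since only the conductance is required to have zero row sums (no shunt conductance).
\<close>

definition no_off_nominal_taps ::
    "('e \<Rightarrow> 'b) \<Rightarrow> ('e \<Rightarrow> 'b) \<Rightarrow> complex ^ 'b ^ 'b \<Rightarrow> bool" where
  "no_off_nominal_taps src snk Y \<longleftrightarrow>
     transpose Y = Y \<and>
     (\<forall>i j. adjacent src snk i j \<longrightarrow> Re (- (Y $ i $ j)) \<ge> 0 \<and> Im (- (Y $ i $ j)) < 0) \<and>
     (\<forall>i j. i \<noteq> j \<and> \<not> adjacent src snk i j \<longrightarrow> Y $ i $ j = 0) \<and>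
     (\<forall>i. conductance Y $ i $ i = - (\<Sum>j \<in> UNIV - {i}. conductance Y $ i $ j))"

subsection \<open>Network matrices\<close>

definition incidence :: "('e \<Rightarrow> 'b) \<Rightarrow> ('e \<Rightarrow> 'b) \<Rightarrow> real ^ 'e ^ 'b" where
  "incidence src snk = (\<chi> k e. if k = src e then 1 else if k = snk e then -1 else 0)"

definition reduced_incidence ::
    "('e \<Rightarrow> 'n::finite option) \<Rightarrow> ('e \<Rightarrow> 'n option) \<Rightarrow> real ^ 'e ^ 'n" where
  "reduced_incidence src snk = (\<chi> k e. incidence src snk $ Some k $ e)"

definition unsigned_reduced_incidence ::
    "('e \<Rightarrow> 'n::finite option) \<Rightarrow> ('e \<Rightarrow> 'n option) \<Rightarrow> real ^ 'e ^ 'n" where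
  "unsigned_reduced_incidence src snk =
     (\<chi> k e. if reduced_incidence src snk $ k $ e = 0 then 0 else 1)"

definition branch_B ::
    "('e \<Rightarrow> 'b) \<Rightarrow> ('e \<Rightarrow> 'b) \<Rightarrow> complex ^ 'b ^ 'b \<Rightarrow> real ^ 'b \<Rightarrow> real ^ 'e ^ 'e" where
  "branch_B src snk Y V =
     (\<chi> e f. if e = f then V $ src e * V $ snk e * susceptance Y $ src e $ snk e else 0)"

definition branch_G ::
    "('e \<Rightarrow> 'b) \<Rightarrow> ('e \<Rightarrow> 'b) \<Rightarrow> complex ^ 'b ^ 'b \<Rightarrow> real ^ 'b \<Rightarrow> real ^ 'e ^ 'e" where
  "branch_G src snk Y V =
     (\<chi> e f. if e = f then V $ src e * V $ snk e * \<bar>conductance Y $ src e $ snk e\<bar> else 0)"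

definition laplacian_B ::
    "('e::finite \<Rightarrow> 'n::finite option) \<Rightarrow> ('e \<Rightarrow> 'n option) \<Rightarrow>
     complex ^ ('n option) ^ ('n option) \<Rightarrow> real ^ ('n option) \<Rightarrow> real ^ 'n ^ 'n" where
  "laplacian_B src snk Y V =
     reduced_incidence src snk ** branch_B src snk Y V ** transpose (reduced_incidence src snk)"

text \<open>Matrix norm induced by \<^const>\<open>infnorm\<close>: the maximum absolute row sum.\<close>

definition matrix_infnorm :: "real ^ 'a::finite ^ 'b::finite \<Rightarrow> real" where
  "matrix_infnorm M = Max (range (\<lambda>i. \<Sum>j\<in>UNIV. \<bar>M $ i $ j\<bar>))"

subsection \<open>Power flow\<close>

definition bus_angle :: "real ^ 'n \<Rightarrow> 'n option \<Rightarrow> real" where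
  "bus_angle \<theta> k = (case k of None \<Rightarrow> 0 | Some i \<Rightarrow> \<theta> $ i)"

definition active_power_flow ::
    "complex ^ ('n::finite option) ^ ('n option) \<Rightarrow> real ^ ('n option) \<Rightarrow> real ^ 'n \<Rightarrow>
     real ^ 'n \<Rightarrow> bool" where
  "active_power_flow Y V P \<theta> \<longleftrightarrow> (\<forall>i :: 'n.
     P $ i =
       (\<Sum>j \<in> UNIV - {Some i}. susceptance Y $ Some i $ j * V $ Some i * V $ j *
          sin (bus_angle \<theta> (Some i) - bus_angle \<theta> j)) +
       conductance Y $ Some i $ Some i * (V $ Some i)\<^sup>2 +
       (\<Sum>j \<in> UNIV - {Some i}. conductance Y $ Some i $ j * V $ Some i * V $ j *
          cos (bus_angle \<theta> (Some i) - bus_angle \<theta> j)))"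

end

(* In a tree both A_r and its transpose are injective: a vector in the kernel of the transpose is
   constant along branches and vanishes at the slack bus, and the support of a vector in the kernel
   of A_r has no leaves, so it would contain a cycle. Hence A_r is invertible, and multiplying the
   power flow equations by D_B^-1 A_r^-1 gives
     sin psi = psi_MDC - M (1 - cos psi),   psi = A_r^T theta,   M = D_B^-1 A_r^-1 |A|_r D_G.
   With rho = |M| the right-hand side maps the cube |psi| <= t, t = arcsin beta_-, into
   [-sin t, sin t]^m, because Gamma + rho (1 - cos t) = sin t. Brouwer's theorem gives a solution.
   Two solutions in the cube agree because |cos a - cos b| <= tan t |sin a - sin b| there and
   rho tan t < 1. A solution with |psi| = r satisfies sin r <= Gamma + rho (1 - cos r), which fails
   when beta_- < sin r < beta_+. *)

theory Submission
  imports Defs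
begin

section \<open>Matrices and norms\<close>

text \<open>\<open>matrix_inv\<close> chooses some two-sided inverse. Two-sided inverses are unique
  even between different index types, so an explicit candidate pins the choice down.\<close>

lemma matrix_inv_eqI:
  fixes A :: "real ^ 'n ^ 'm" and B :: "real ^ 'm ^ 'n"
  assumes AB: "A ** B = mat 1" and BA: "B ** A = mat 1"
  shows "matrix_inv A = B"
proof -
  have "A ** matrix_inv A = mat 1 \<and> matrix_inv A ** A = mat 1"
    unfolding matrix_inv_def by (rule someI[where x = B]) (use AB BA in simp)
  then have "B = B ** (A ** matrix_inv A)"
    by simp
  also have "\<dots> = matrix_inv A"
    by (simp add: matrix_mul_assoc BA)
  finally show ?thesis ..
qed

lemma diag_mult_diag:
  fixes a b :: "'e::finite \<Rightarrow> real"
  assumes "\<And>e. a e * b e = 1"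
  shows "(\<chi> e f. if e = f then a e else 0) ** (\<chi> e f. if e = f then b e else 0) = mat 1"
  unfolding matrix_matrix_mult_def mat_def
  by (auto simp: vec_eq_iff if_distrib[of "\<lambda>x. x * _"] assms cong: if_cong)

lemma diag_mult_vec_component:
  fixes a :: "'e::finite \<Rightarrow> real"
  shows "((\<chi> e f. if e = f then a e else 0) *v x) $ e = a e * x $ e"
  unfolding matrix_vector_mult_def
  by (simp add: if_distrib[of "\<lambda>x. x * _"] cong: if_cong)

lemma infnorm_attained_cart:
  fixes x :: "real ^ 'e::finite"
  obtains e where "infnorm x = \<bar>x $ e\<bar>"
proof -
  have eq: "infnorm x = Sup (range (\<lambda>i. \<bar>x $ i\<bar>))"
    by (simp add: infnorm_cart full_SetCompr_eq)
  have "Sup (range (\<lambda>i. \<bar>x $ i\<bar>)) = Max (range (\<lambda>i. \<bar>x $ i\<bar>))"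
    by (rule cSup_eq_Max) auto
  also have "\<dots> \<in> range (\<lambda>i. \<bar>x $ i\<bar>)"
    by (rule Max_in) auto
  finally show ?thesis
    using that eq by auto
qed

lemma infnorm_le_iff_cart:
  fixes x :: "real ^ 'e::finite"
  shows "infnorm x \<le> c \<longleftrightarrow> (\<forall>e. \<bar>x $ e\<bar> \<le> c)"
  by (metis component_le_infnorm_cart infnorm_attained_cart order_trans)

lemma matrix_infnorm_nonneg: "0 \<le> matrix_infnorm M"
proof -
  have "0 \<le> (\<Sum>j\<in>UNIV. \<bar>M $ i $ j\<bar>)" for i
    by (simp add: sum_nonneg)
  also have "(\<Sum>j\<in>UNIV. \<bar>M $ i $ j\<bar>) \<le> matrix_infnorm M" for i
    unfolding matrix_infnorm_def by (rule Max_ge) auto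
  finally show ?thesis .
qed

lemma matrix_infnorm_mult_bound:
  assumes "\<And>j. \<bar>x $ j\<bar> \<le> c"
  shows "\<bar>(M *v x) $ i\<bar> \<le> matrix_infnorm M * c"
proof -
  have "0 \<le> c"
    using assms abs_ge_zero order_trans by blast
  have "\<bar>(M *v x) $ i\<bar> \<le> (\<Sum>j\<in>UNIV. \<bar>M $ i $ j * x $ j\<bar>)"
    unfolding matrix_vector_mult_def by (simp add: sum_abs)
  also have "\<dots> \<le> (\<Sum>j\<in>UNIV. \<bar>M $ i $ j\<bar> * c)"
    by (intro sum_mono) (simp add: abs_mult assms mult_left_mono)
  also have "\<dots> = (\<Sum>j\<in>UNIV. \<bar>M $ i $ j\<bar>) * c"
    by (simp add: sum_distrib_right)
  also have "\<dots> \<le> matrix_infnorm M * c"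
    unfolding matrix_infnorm_def by (intro mult_right_mono Max_ge \<open>0 \<le> c\<close>) auto
  finally show ?thesis .
qed

text \<open>Serves the strictness \<open>\<beta>\<^sub>m < \<beta>\<^sub>p\<close>, where
  \<open>\<rho> = 0\<close> has to be traced back to the matrix.\<close>

lemma matrix_infnorm_eq_0D:
  assumes "matrix_infnorm M = 0"
  shows "M = 0"
proof -
  have "(\<Sum>j\<in>UNIV. \<bar>M $ i $ j\<bar>) \<le> 0" for i
    unfolding assms[symmetric] matrix_infnorm_def by (rule Max_ge) auto
  then have "(\<Sum>j\<in>UNIV. \<bar>M $ i $ j\<bar>) = 0" for i
    by (meson abs_ge_zero order_antisym sum_nonneg)
  then show ?thesis
    by (simp add: vec_eq_iff sum_nonneg_eq_0_iff)
qed

section \<open>Incidence matrices of trees\<close>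

text \<open>Longest path argument: the first vertex of a longest simple path has a second neighbour,
  which by maximality lies on the path, so an initial segment closes up to a cycle.\<close>

lemma ex_cycle_if_no_leaf:
  fixes R :: "'b::finite \<Rightarrow> 'b \<Rightarrow> bool"
  assumes "R a b" and irrefl: "\<And>x. \<not> R x x" and sym: "\<And>x y. R x y \<Longrightarrow> R y x"
    and two: "\<And>x y. R x y \<Longrightarrow> \<exists>z. z \<noteq> y \<and> R x z"
  shows "\<exists>vs. 3 \<le> length vs \<and> distinct vs \<and>
    (\<forall>k < length vs. R (vs ! k) (vs ! (Suc k mod length vs)))"
proof -
  define path where "path vs \<longleftrightarrow> 2 \<le> length vs \<and> distinct vs \<and>
    (\<forall>k. Suc k < length vs \<longrightarrow> R (vs ! k) (vs ! Suc k))" for vs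
  have "path [a, b]"
    using assms(1) irrefl by (auto simp: path_def)
  \<comment> \<open>A distinct list is no longer than the number of vertices; this bound makes a
    longest path exist.\<close>
  moreover have "length vs < Suc (card (UNIV :: 'b set))" if "path vs" for vs
    using that distinct_card[of vs] card_mono[of "UNIV :: 'b set" "set vs"]
    by (simp add: path_def)
  ultimately obtain vs where vs: "path vs" and max: "\<And>ws. path ws \<Longrightarrow> length ws \<le> length vs"
    using ex_has_greatest_nat[of path "[a, b]" length "Suc (card (UNIV :: 'b set))"] by metis
  then have len: "2 \<le> length vs" and dist: "distinct vs"
    and edge: "\<And>k. Suc k < length vs \<Longrightarrow> R (vs ! k) (vs ! Suc k)"
    by (auto simp: path_def)
  obtain z where z: "z \<noteq> vs ! 1" "R (vs ! 0) z"
    using two[OF edge[of 0]] len by auto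
  have "z \<in> set vs"
  proof (rule ccontr)
    assume "z \<notin> set vs"
    then have "path (z # vs)"
      using len dist edge sym[OF z(2)] by (auto simp: path_def nth_Cons split: nat.split)
    then show False
      using max by force
  qed
  then obtain k where k: "k < length vs" "vs ! k = z"
    by (auto simp: in_set_conv_nth)
  \<comment> \<open>Position 0 would be a loop, position 1 is the neighbour already used. Hence the
    initial segment up to \<open>k\<close> has at least three vertices.\<close>
  have "k \<noteq> 0" "k \<noteq> 1"
    using z irrefl k by metis+
  then have "2 \<le> k"
    by simp
  \<comment> \<open>Only \<open>i = k\<close> wraps around; it is the closing edge from
    \<open>z\<close> back to the first vertex.\<close>
  have nxt: "R (take (Suc k) vs ! i) (take (Suc k) vs ! (Suc i mod Suc k))" if "i < Suc k" for i
  proof (cases "i = k")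
    case True
    then show ?thesis
      using k z sym by simp
  next
    case False
    then show ?thesis
      using that edge[of i] k by simp
  qed
  show ?thesis
    using \<open>2 \<le> k\<close> k dist nxt by (intro exI[of _ "take (Suc k) vs"]) auto
qed

lemma incidence_column_sum:
  fixes src snk :: "'e::finite \<Rightarrow> 'b::finite"
  assumes "src e \<noteq> snk e"
  shows "(\<Sum>k\<in>UNIV. incidence src snk $ k $ e) = 0"
proof -
  have "(\<Sum>k\<in>UNIV. incidence src snk $ k $ e)
    = (\<Sum>k\<in>UNIV. (if k = src e then 1 else 0) + (if k = snk e then -1 else 0))"
    using assms by (intro sum.cong) (auto simp: incidence_def)
  also have "\<dots> = 0"
    by (simp add: sum.distrib)
  finally show ?thesis .
qed

text \<open>Deleting the slack row costs nothing, because \<open>bus_angle\<close> is 0 at the slack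
  bus.\<close>

lemma reduced_incidence_transpose_component:
  assumes "src e \<noteq> snk e"
  shows "(transpose (reduced_incidence src snk) *v \<theta>) $ e
    = bus_angle \<theta> (src e) - bus_angle \<theta> (snk e)"
proof -
  have "(transpose (reduced_incidence src snk) *v \<theta>) $ e
    = (\<Sum>k\<in>UNIV. (if src e = Some k then \<theta> $ k else 0) - (if snk e = Some k then \<theta> $ k else 0))"
    unfolding matrix_vector_mult_def transpose_def reduced_incidence_def incidence_def
    using assms by (auto intro!: sum.cong)
  also have "\<dots> = bus_angle \<theta> (src e) - bus_angle \<theta> (snk e)"
    by (cases "src e"; cases "snk e") (simp_all add: sum_subtractf sum_negf bus_angle_def)
  finally show ?thesis .
qed

lemma inj_reduced_incidence_transpose:
  assumes "simple_network src snk" "connected_network src snk"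
  shows "inj ((*v) (transpose (reduced_incidence src snk)))"
proof -
  have "\<theta> = 0" if "transpose (reduced_incidence src snk) *v \<theta> = 0" for \<theta>
  proof -
    have "src e \<noteq> snk e" for e
      using assms(1) by (simp add: simple_network_def)
    then have "bus_angle \<theta> (src e) = bus_angle \<theta> (snk e)" for e
      using reduced_incidence_transpose_component[of src e snk \<theta>] that by simp
    then have adj: "bus_angle \<theta> i = bus_angle \<theta> j" if "adjacent src snk i j" for i j
      using that by (auto simp: adjacent_def)
    have "bus_angle \<theta> i = bus_angle \<theta> j" if "(adjacent src snk)\<^sup>*\<^sup>* i j" for i j
      using that by induction (auto dest: adj)
    then have "bus_angle \<theta> (Some k) = bus_angle \<theta> None" for k
      using assms(2) by (simp add: connected_network_def)
    then show "\<theta> = 0"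
      by (simp add: bus_angle_def vec_eq_iff)
  qed
  then show ?thesis
    by (simp add: matrix_left_invertible_injective[symmetric] matrix_left_invertible_ker)
qed

text \<open>Balance at the slack bus follows from balance at all other buses, since each column of
  the full incidence matrix sums to zero. Hence \<open>k\<close> may be any bus.\<close>

lemma kernel_reduced_incidence:
  fixes src snk :: "'e::finite \<Rightarrow> 'n::finite option"
  assumes "\<And>e. src e \<noteq> snk e" "reduced_incidence src snk *v x = 0"
  shows "(\<Sum>e\<in>UNIV. incidence src snk $ k $ e * x $ e) = 0"
proof -
  define S where "S k = (\<Sum>e\<in>UNIV. incidence src snk $ k $ e * x $ e)" for k
  have some: "S (Some k) = 0" for k
    using assms(2) by (simp add: S_def vec_eq_iff matrix_vector_mult_def reduced_incidence_def)
  have "(\<Sum>k\<in>UNIV. S k) = (\<Sum>e\<in>UNIV. (\<Sum>k\<in>UNIV. incidence src snk $ k $ e) * x $ e)"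
    unfolding S_def by (subst sum.swap) (simp add: sum_distrib_right)
  also have "\<dots> = 0"
    by (simp add: incidence_column_sum assms(1))
  finally have "S None + (\<Sum>k\<in>UNIV. S (Some k)) = 0"
    by (simp add: UNIV_option_conv sum.reindex)
  then have "S None = 0"
    by (simp add: some)
  with some show ?thesis
    unfolding S_def by (cases k) auto
qed

lemma inj_reduced_incidence:
  fixes src snk :: "'e::finite \<Rightarrow> 'n::finite option"
  assumes simple: "simple_network src snk"
    and acyclic: "\<not> (\<exists>vs. network_cycle src snk vs)"
  shows "inj ((*v) (reduced_incidence src snk))"
proof -
  have loop: "src e \<noteq> snk e" for e
    using simple by (simp add: simple_network_def)
  have "x = 0" if x: "reduced_incidence src snk *v x = 0" for x :: "real ^ 'e"
  proof (rule ccontr)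
    assume "x \<noteq> 0"
    then obtain e0 where e0: "x $ e0 \<noteq> 0"
      by (auto simp: vec_eq_iff)
    \<comment> \<open>The support of \<open>x\<close> viewed as a graph; flow balance at each bus
      will rule out leaves.\<close>
    define R where "R i j \<longleftrightarrow> (\<exists>e. x $ e \<noteq> 0 \<and> {src e, snk e} = {i, j})" for i j
    have "\<exists>vs. 3 \<le> length vs \<and> distinct vs \<and>
      (\<forall>k < length vs. R (vs ! k) (vs ! (Suc k mod length vs)))"
    proof (rule ex_cycle_if_no_leaf)
      show "R (src e0) (snk e0)"
        using e0 by (auto simp: R_def)
      show "\<not> R i i" for i
        unfolding R_def by (metis insert_absorb2 insertCI loop singletonD)
      show "R j i" if "R i j" for i j
        using that by (simp add: R_def insert_commute)
      show "\<exists>l. l \<noteq> j \<and> R i l" if "R i j" for i j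
      proof -
        obtain e where e: "x $ e \<noteq> 0" "{src e, snk e} = {i, j}"
          using \<open>R i j\<close> by (auto simp: R_def)
        \<comment> \<open>With \<open>e\<close> as the only support branch at \<open>i\<close>, the
          balance at \<open>i\<close> would reduce to one nonzero term.\<close>
        have "\<exists>f. f \<noteq> e \<and> incidence src snk $ i $ f * x $ f \<noteq> 0"
        proof (rule ccontr)
          assume "\<not> ?thesis"
          then have "(\<Sum>f\<in>UNIV - {e}. incidence src snk $ i $ f * x $ f) = 0"
            by (intro sum.neutral) blast
          then have "incidence src snk $ i $ e * x $ e = 0"
            using kernel_reduced_incidence[where k = i, OF loop x]
            by (simp add: sum.remove[where x = e])
          moreover have "i = src e \<or> i = snk e"
            using e(2) by blast
          ultimately show False
            using e(1) by (auto simp: incidence_def split: if_splits)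
        qed
        then obtain f where f: "f \<noteq> e" "x $ f \<noteq> 0" "incidence src snk $ i $ f \<noteq> 0"
          by auto
        then have "i = src f \<or> i = snk f"
          by (auto simp: incidence_def split: if_splits)
        then obtain l where l: "{src f, snk f} = {i, l}"
          by blast
        \<comment> \<open>\<open>l = j\<close> would make \<open>e\<close> and \<open>f\<close>
          parallel branches.\<close>
        then have "l \<noteq> j"
          using e f simple by (auto simp: simple_network_def)
        with f l show ?thesis
          by (auto simp: R_def)
      qed
    qed
    moreover have "adjacent src snk i j" if "R i j" for i j
      using that by (auto simp: R_def adjacent_def doubleton_eq_iff)
    ultimately show False
      using acyclic unfolding network_cycle_def by blast
  qed
  then show ?thesis
    by (simp add: matrix_left_invertible_injective[symmetric] matrix_left_invertible_ker)
qed

text \<open>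
  \<open>'e\<close> and \<open>'n\<close> are different types, so invertibility needs both one-sided inverses; injectivity of
  \<open>A\<close> and of its transpose supplies them without counting \<open>CARD('e) = CARD('n)\<close>.
\<close>

lemma reduced_incidence_inverse:
  fixes src snk :: "'e::finite \<Rightarrow> 'n::finite option"
  assumes "radial_network src snk"
  defines "A \<equiv> reduced_incidence src snk"
  shows "A ** matrix_inv A = mat 1" "matrix_inv A ** A = mat 1"
proof -
  obtain B :: "real ^ 'n ^ 'e" where B: "B ** A = mat 1"
    using inj_reduced_incidence assms
    by (metis matrix_left_invertible_injective radial_network_def)
  obtain C :: "real ^ 'e ^ 'n" where "C ** transpose A = mat 1"
    using inj_reduced_incidence_transpose assms
    by (metis matrix_left_invertible_injective radial_network_def)
  then have C: "A ** transpose C = mat 1"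
    by (metis matrix_transpose_mul transpose_mat transpose_transpose)
  have "B = B ** (A ** transpose C)"
    using C by simp
  also have "\<dots> = transpose C"
    by (simp add: matrix_mul_assoc B)
  finally have "A ** B = mat 1"
    using C by simp
  then show "A ** matrix_inv A = mat 1" "matrix_inv A ** A = mat 1"
    using B matrix_inv_eqI by metis+
qed

text \<open>In a simple graph the branches at \<open>k\<close> correspond bijectively to the
  neighbours of \<open>k\<close>, by passing to the opposite end. This turns bus sums into rows of
  incidence matrices.\<close>

lemma sum_neighbours:
  fixes src snk :: "'e::finite \<Rightarrow> 'b::finite"
  assumes simple: "simple_network src snk"
    and zero: "\<And>j. j \<noteq> k \<Longrightarrow> \<not> adjacent src snk k j \<Longrightarrow> F j = (0::real)"
  shows "(\<Sum>j\<in>UNIV - {k}. F j)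
    = (\<Sum>e\<in>UNIV. if k = src e then F (snk e) else if k = snk e then F (src e) else 0)"
proof -
  define other where "other e = (if k = src e then snk e else src e)" for e
  let ?E = "{e. k = src e \<or> k = snk e}" and ?N = "{j. adjacent src snk k j}"
  have loop: "src e \<noteq> snk e" for e
    using simple by (simp add: simple_network_def)
  have ends: "{src e, snk e} = {k, other e}" if "e \<in> ?E" for e
    using that by (auto simp: other_def)
  have "inj_on other ?E"
    using simple ends unfolding inj_on_def simple_network_def by metis
  moreover have "other ` ?E = ?N"
  proof
    show "other ` ?E \<subseteq> ?N"
      by (auto simp: other_def adjacent_def)
    show "?N \<subseteq> other ` ?E"
    proof
      fix j
      assume "j \<in> ?N"
      then obtain e where "src e = k \<and> snk e = j \<or> src e = j \<and> snk e = k"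
        by (auto simp: adjacent_def)
      then have "e \<in> ?E" "other e = j"
        using loop[of e] by (auto simp: other_def)
      then show "j \<in> other ` ?E"
        by blast
    qed
  qed
  ultimately have bij: "bij_betw other ?E ?N"
    by (simp add: bij_betw_def)
  have "(\<Sum>j\<in>UNIV - {k}. F j) = (\<Sum>j\<in>?N. F j)"
    using zero loop[symmetric] loop
    by (intro sum.mono_neutral_right) (auto simp: adjacent_def)
  also have "\<dots> = (\<Sum>e\<in>?E. F (other e))"
    using sum.reindex_bij_betw[OF bij] by metis
  also have "\<dots> = (\<Sum>e\<in>UNIV. if e \<in> ?E then F (other e) else 0)"
    by (simp add: sum.If_cases)
  also have "\<dots> = (\<Sum>e\<in>UNIV. if k = src e then F (snk e) else if k = snk e then F (src e) else 0)"
    by (intro sum.cong) (auto simp: other_def)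
  finally show ?thesis .
qed

section \<open>Branch form of the power flow equations\<close>

text \<open>Zero row sums of the conductance, with equal voltages, merge the diagonal term into the
  cosines as factors \<open>1 - cos\<close>. Sine is odd and cosine even in the orientation, hence
  the signed matrix for one and the unsigned matrix for the other.\<close>

lemma active_power_flow_iff_incidence:
  fixes src snk :: "'e::finite \<Rightarrow> 'n::finite option"
  assumes simple: "simple_network src snk"
    and taps: "no_off_nominal_taps src snk Y"
    and v: "\<And>i. V $ i = v"
  defines "A \<equiv> reduced_incidence src snk" and "U \<equiv> unsigned_reduced_incidence src snk"
  shows "active_power_flow Y V P \<theta> \<longleftrightarrow>
    P = A *v (branch_B src snk Y V *v (\<chi> e. sin ((transpose A *v \<theta>) $ e)))
      + U *v (branch_G src snk Y V *v (\<chi> e. 1 - cos ((transpose A *v \<theta>) $ e)))"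
proof -
  have loop: "src e \<noteq> snk e" for e
    using simple by (simp add: simple_network_def)
  have sym: "Y $ i $ j = Y $ j $ i" for i j
    using taps by (auto simp: no_off_nominal_taps_def transpose_def vec_eq_iff)
  \<comment> \<open>Off-diagonal conductances are nonpositive on branches and zero
    elsewhere.\<close>
  have G_neg: "\<bar>conductance Y $ i $ j\<bar> = - conductance Y $ i $ j" if "i \<noteq> j" for i j
    using taps that by (cases "adjacent src snk i j")
      (auto simp: no_off_nominal_taps_def conductance_def abs_of_nonpos)
  define ba where "ba = bus_angle \<theta>"
  have \<psi>: "(transpose A *v \<theta>) $ e = ba (src e) - ba (snk e)" for e
    unfolding A_def ba_def using loop by (rule reduced_incidence_transpose_component)
  let ?B = "\<lambda>i j. susceptance Y $ i $ j * v * v * sin (ba i - ba j)"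
  let ?G = "\<lambda>i j. conductance Y $ i $ j * v * v"
  let ?F = "\<lambda>i j. ?B i j - ?G i j * (1 - cos (ba i - ba j))"
  have rhs: "(\<Sum>j \<in> UNIV - {k}. ?B k j) + conductance Y $ k $ k * v\<^sup>2
      + (\<Sum>j \<in> UNIV - {k}. ?G k j * cos (ba k - ba j)) = (\<Sum>j \<in> UNIV - {k}. ?F k j)" for k
  proof -
    have "conductance Y $ k $ k * v\<^sup>2 = (\<Sum>j \<in> UNIV - {k}. - ?G k j)"
      using taps by (simp add: no_off_nominal_taps_def sum_distrib_right sum_negf
          power2_eq_square mult.assoc)
    then show ?thesis
      by (simp add: sum.distrib[symmetric] algebra_simps)
  qed
  have comp: "(\<Sum>j \<in> UNIV - {Some i}. ?F (Some i) j) =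
    (A *v (branch_B src snk Y V *v (\<chi> e. sin ((transpose A *v \<theta>) $ e)))
      + U *v (branch_G src snk Y V *v (\<chi> e. 1 - cos ((transpose A *v \<theta>) $ e)))) $ i" for i
  proof -
    have "(\<Sum>j \<in> UNIV - {Some i}. ?F (Some i) j) =
      (\<Sum>e\<in>UNIV. if Some i = src e then ?F (Some i) (snk e)
        else if Some i = snk e then ?F (Some i) (src e) else 0)"
      using taps by (intro sum_neighbours simple)
        (auto simp: no_off_nominal_taps_def susceptance_def conductance_def)
    also have "\<dots> = (\<Sum>e\<in>UNIV.
        A $ i $ e * (v * v * susceptance Y $ src e $ snk e * sin (ba (src e) - ba (snk e)))
      + U $ i $ e * (v * v * \<bar>conductance Y $ src e $ snk e\<bar> * (1 - cos (ba (src e) - ba (snk e)))))"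
    proof (rule sum.cong)
      fix e
      have "sin (ba (snk e) - ba (src e)) = - sin (ba (src e) - ba (snk e))"
        "cos (ba (snk e) - ba (src e)) = cos (ba (src e) - ba (snk e))"
        by (simp_all add: sin_diff cos_diff algebra_simps)
      then show "(if Some i = src e then ?F (Some i) (snk e)
          else if Some i = snk e then ?F (Some i) (src e) else 0) =
        A $ i $ e * (v * v * susceptance Y $ src e $ snk e * sin (ba (src e) - ba (snk e)))
        + U $ i $ e * (v * v * \<bar>conductance Y $ src e $ snk e\<bar> * (1 - cos (ba (src e) - ba (snk e))))"
        using loop[of e] sym[of "src e" "snk e"] G_neg[of "src e" "snk e"]
        by (simp add: A_def U_def reduced_incidence_def unsigned_reduced_incidence_def
            incidence_def susceptance_def conductance_def algebra_simps)
    qed simp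
    also have "\<dots> = (A *v (branch_B src snk Y V *v (\<chi> e. sin ((transpose A *v \<theta>) $ e)))
      + U *v (branch_G src snk Y V *v (\<chi> e. 1 - cos ((transpose A *v \<theta>) $ e)))) $ i"
      unfolding branch_B_def branch_G_def v \<psi>
      by (simp add: matrix_vector_mult_def[of A] matrix_vector_mult_def[of U]
          diag_mult_vec_component sum.distrib mult.assoc)
    finally show ?thesis .
  qed
  show ?thesis
    unfolding active_power_flow_def v vec_eq_iff ba_def[symmetric] rhs comp ..
qed

lemma branch_B_inverse:
  fixes src snk :: "'e::finite \<Rightarrow> 'n::finite"
  assumes taps: "no_off_nominal_taps src snk Y" and v: "\<And>i. V $ i > 0"
  defines "D \<equiv> branch_B src snk Y V"
  shows "D ** matrix_inv D = mat 1" "matrix_inv D ** D = mat 1"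
proof -
  define D' where "D' = (\<chi> e f. if e = f
    then 1 / (V $ src e * V $ snk e * susceptance Y $ src e $ snk e) else (0::real))"
  have "susceptance Y $ src e $ snk e > 0" for e
    using taps by (auto simp: no_off_nominal_taps_def susceptance_def adjacent_def)
  then have "V $ src e * V $ snk e * susceptance Y $ src e $ snk e > 0" for e
    using v by simp
  then have "V $ src e * V $ snk e * susceptance Y $ src e $ snk e \<noteq> 0" for e
    by (metis less_irrefl)
  then have "D ** D' = mat 1" "D' ** D = mat 1"
    unfolding D_def D'_def branch_B_def by (auto intro!: diag_mult_diag)
  then show "D ** matrix_inv D = mat 1" "matrix_inv D ** D = mat 1"
    using matrix_inv_eqI by metis+
qed

text \<open>All three factors of the Laplacian are invertible, so its inverse factors too and the
  MDC vector collapses to \<open>D' *v (A' *v P)\<close>. An equivalence is needed because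
  uniqueness and nonexistence speak about every solution.\<close>

lemma active_power_flow_iff_branch:
  fixes src snk :: "'e::finite \<Rightarrow> 'n::finite option"
  assumes radial: "radial_network src snk"
    and taps: "no_off_nominal_taps src snk Y"
    and v: "v > 0" "\<And>i. V $ i = v"
  defines "A \<equiv> reduced_incidence src snk" and "D \<equiv> branch_B src snk Y V"
  shows "active_power_flow Y V P \<theta> \<longleftrightarrow>
    (\<chi> e. sin ((transpose A *v \<theta>) $ e)) =
      transpose A *v (matrix_inv (laplacian_B src snk Y V) *v P)
      - (matrix_inv D ** matrix_inv A ** unsigned_reduced_incidence src snk ** branch_G src snk Y V)
        *v (\<chi> e. 1 - cos ((transpose A *v \<theta>) $ e))"
    (is "_ \<longleftrightarrow> ?s = ?p - ?M *v ?c")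
proof -
  define A' where "A' = matrix_inv A"
  define D' where "D' = matrix_inv D"
  define U where "U = unsigned_reduced_incidence src snk"
  define G where "G = branch_G src snk Y V"
  have A: "A ** A' = mat 1" "A' ** A = mat 1"
    using reduced_incidence_inverse[OF radial] by (auto simp: A_def A'_def)
  have D: "D ** D' = mat 1" "D' ** D = mat 1"
    using branch_B_inverse[OF taps] v by (simp_all add: D_def D'_def)
  have AT: "transpose A ** transpose A' = mat 1" "transpose A' ** transpose A = mat 1"
    by (simp_all add: matrix_transpose_mul[symmetric] A)
  have "matrix_inv (laplacian_B src snk Y V) = transpose A' ** D' ** A'"
  proof (rule matrix_inv_eqI)
    have "A ** D ** transpose A ** (transpose A' ** D' ** A')
        = A ** D ** (transpose A ** transpose A') ** D' ** A'"
      by (simp add: matrix_mul_assoc)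
    also have "\<dots> = A ** (D ** D') ** A'"
      by (simp add: AT matrix_mul_assoc)
    also have "\<dots> = mat 1"
      by (simp add: A D)
    finally show "laplacian_B src snk Y V ** (transpose A' ** D' ** A') = mat 1"
      by (simp add: laplacian_B_def A_def D_def)
    have "(transpose A' ** D' ** A') ** (A ** D ** transpose A)
        = transpose A' ** D' ** (A' ** A) ** D ** transpose A"
      by (simp add: matrix_mul_assoc)
    also have "\<dots> = transpose A' ** (D' ** D) ** transpose A"
      by (simp add: A matrix_mul_assoc)
    also have "\<dots> = mat 1"
      by (simp add: AT D)
    finally show "(transpose A' ** D' ** A') ** laplacian_B src snk Y V = mat 1"
      by (simp add: laplacian_B_def A_def D_def)
  qed
  then have p: "?p = D' *v (A' *v P)"
    by (simp add: matrix_vector_mul_assoc matrix_mul_assoc AT)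
  have M: "?M *v ?c = D' *v (A' *v (U *v (G *v ?c)))"
    by (simp add: D'_def A'_def U_def G_def matrix_vector_mul_assoc matrix_mul_assoc)
  have "P = A *v (D *v ?s) + U *v (G *v ?c) \<longleftrightarrow> ?s + D' *v (A' *v (U *v (G *v ?c))) = D' *v (A' *v P)"
    (is "?L \<longleftrightarrow> ?R")
  proof
    assume ?L
    have "D' *v (A' *v (A *v (D *v ?s))) = (D' ** (A' ** A) ** D) *v ?s"
      by (simp only: matrix_vector_mul_assoc matrix_mul_assoc)
    also have "\<dots> = ?s"
      by (simp add: A D)
    finally show ?R
      by (subst \<open>?L\<close>) (simp add: matrix_vector_right_distrib)
  next
    assume ?R
    then have "A *v (D *v (D' *v (A' *v P))) = A *v (D *v (?s + D' *v (A' *v (U *v (G *v ?c)))))"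
      by simp
    moreover have "A *v (D *v (D' *v (A' *v x))) = x" for x
    proof -
      have "A *v (D *v (D' *v (A' *v x))) = (A ** (D ** D') ** A') *v x"
        by (simp only: matrix_vector_mul_assoc matrix_mul_assoc)
      then show ?thesis
        by (simp add: A D)
    qed
    ultimately show ?L
      by (simp add: matrix_vector_right_distrib)
  qed
  moreover have "active_power_flow Y V P \<theta> \<longleftrightarrow> P = A *v (D *v ?s) + U *v (G *v ?c)"
    using radial unfolding A_def D_def U_def G_def radial_network_def
    by (intro active_power_flow_iff_incidence[OF _ taps v(2)]) simp
  ultimately show ?thesis
    unfolding p M by (auto simp: eq_diff_eq)
qed

section \<open>The branch equation\<close>

text \<open>With half sum \<open>m\<close> and half difference \<open>d\<close>, both differences
  contain the factor \<open>2 * \<bar>sin d\<bar>\<close>, and what remains is tan |m| \<le> tan t.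
  The cosine is multiplied out to avoid division.\<close>

lemma abs_cos_diff_le:
  assumes "\<bar>a\<bar> \<le> t" "\<bar>b\<bar> \<le> t" "t < pi / 2"
  shows "\<bar>cos a - cos b\<bar> * cos t \<le> sin t * \<bar>sin a - sin b\<bar>"
proof -
  define m d where "m = (a + b) / 2" and "d = (a - b) / 2"
  have m: "\<bar>m\<bar> \<le> t"
    using assms by (auto simp: m_def abs_le_iff)
  \<comment> \<open>Expanding this sine gives the comparison of tangents in multiplied form.\<close>
  then have "0 \<le> sin (t - \<bar>m\<bar>)"
    using assms by (intro sin_ge_zero) auto
  then have "sin \<bar>m\<bar> * cos t \<le> sin t * cos \<bar>m\<bar>"
    by (simp add: sin_diff mult.commute)
  moreover have "sin \<bar>m\<bar> = \<bar>sin m\<bar>" "0 \<le> cos m"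
    using m assms sin_ge_zero[of "\<bar>m\<bar>"] by (auto simp: abs_if cos_ge_zero split: if_splits)
  ultimately have "2 * \<bar>sin d\<bar> * (\<bar>sin m\<bar> * cos t) \<le> 2 * \<bar>sin d\<bar> * (sin t * \<bar>cos m\<bar>)"
    by (intro mult_left_mono) auto
  moreover have "\<bar>cos a - cos b\<bar> = 2 * \<bar>sin m\<bar> * \<bar>sin d\<bar>"
    "\<bar>sin a - sin b\<bar> = 2 * \<bar>sin d\<bar> * \<bar>cos m\<bar>"
    by (simp_all add: cos_diff_cos sin_diff_sin m_def d_def abs_mult)
      (metis abs_minus_cancel minus_diff_eq minus_divide_left sin_minus)
  ultimately show ?thesis
    by (simp add: mult_ac)
qed

text \<open>The branch equation for an arbitrary vector of phase differences. No cycle constraint on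
  \<open>\<psi>\<close> appears, because in a tree every such vector comes from bus angles.\<close>

definition branch_solution :: "real ^ 'e::finite ^ 'e \<Rightarrow> real ^ 'e \<Rightarrow> real ^ 'e \<Rightarrow> bool" where
  "branch_solution M p \<psi> \<longleftrightarrow> (\<chi> e. sin (\<psi> $ e)) = p - M *v (\<chi> e. 1 - cos (\<psi> $ e))"

text \<open>\<open>1 - cos\<close> is even and increasing on [0, pi], so on the cube of radius
  \<open>t\<close> it is at most \<open>1 - cos t\<close>.\<close>

lemma branch_rhs_bound:
  assumes "infnorm \<psi> \<le> t" "t \<le> pi"
  shows "\<bar>(p - M *v (\<chi> e. 1 - cos (\<psi> $ e))) $ e\<bar> \<le> infnorm p + matrix_infnorm M * (1 - cos t)"
proof -
  have "\<bar>(\<chi> e. 1 - cos (\<psi> $ e)) $ f\<bar> \<le> 1 - cos t" for f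
  proof -
    have "cos t \<le> cos \<bar>\<psi> $ f\<bar>"
      using assms infnorm_le_iff_cart[of \<psi> t] by (intro cos_monotone_0_pi_le) auto
    then show ?thesis
      by simp
  qed
  from matrix_infnorm_mult_bound[OF this, of M e] component_le_infnorm_cart[of p e]
  show ?thesis
    by simp
qed

text \<open>Read the equation at a component where the norm is attained, and bound the right-hand
  side on the cube of exactly that radius.\<close>

lemma branch_solution_sin_bound:
  assumes "branch_solution M p \<psi>" "infnorm \<psi> \<le> pi / 2"
  shows "sin (infnorm \<psi>) \<le> infnorm p + matrix_infnorm M * (1 - cos (infnorm \<psi>))"
proof -
  obtain e where e: "infnorm \<psi> = \<bar>\<psi> $ e\<bar>"
    by (rule infnorm_attained_cart)
  have "sin \<bar>\<psi> $ e\<bar> \<le> \<bar>sin (\<psi> $ e)\<bar>"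
    by (simp add: abs_if)
  also have "\<dots> = \<bar>(p - M *v (\<chi> e. 1 - cos (\<psi> $ e))) $ e\<bar>"
    using assms(1) unfolding branch_solution_def by (metis vec_lambda_beta)
  also have "\<dots> \<le> infnorm p + matrix_infnorm M * (1 - cos (infnorm \<psi>))"
    using assms(2) pi_ge_zero by (intro branch_rhs_bound order_refl) linarith
  finally show ?thesis
    by (simp add: e)
qed

lemma branch_solution_exists:
  fixes M :: "real ^ 'e::finite ^ 'e"
  assumes t: "0 \<le> t" "t < pi / 2"
    and bound: "infnorm p + matrix_infnorm M * (1 - cos t) \<le> sin t"
  shows "\<exists>\<psi>. branch_solution M p \<psi> \<and> infnorm \<psi> \<le> t"
proof -
  define f where "f \<psi> = p - M *v (\<chi> e. 1 - cos (\<psi> $ e))" for \<psi> :: "real ^ 'e"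
  define S where "S = cbox (\<chi> e. - t) (\<chi> e. t :: real ^ 'e)"
  have S: "\<psi> \<in> S \<longleftrightarrow> infnorm \<psi> \<le> t" for \<psi> :: "real ^ 'e"
    by (auto simp: S_def mem_box_cart infnorm_le_iff_cart abs_le_iff minus_le_iff)
  have f_bound: "\<bar>f \<psi> $ e\<bar> \<le> sin t" if "\<psi> \<in> S" for \<psi> e
    using branch_rhs_bound[of \<psi> t p M e] bound that t by (simp add: S f_def)
  \<comment> \<open>Keeps the argument of \<open>arcsin\<close> in [-1, 1], where it is continuous
    and inverted by \<open>sin\<close>.\<close>
  have "\<bar>f \<psi> $ e\<bar> \<le> 1" if "\<psi> \<in> S" for \<psi> e
    using f_bound[OF that, of e] sin_le_one[of t] by linarith
  then have f_range: "- 1 \<le> f \<psi> $ e" "f \<psi> $ e \<le> 1" if "\<psi> \<in> S" for \<psi> e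
    using that by (auto simp: abs_le_iff minus_le_iff)
  define F where "F \<psi> = (\<chi> e. arcsin (f \<psi> $ e))" for \<psi>
  have "continuous_on S (\<lambda>\<psi>. M *v (\<chi> e. 1 - cos (\<psi> $ e)))"
    by (rule linear_continuous_on_compose[OF _ matrix_vector_mul_linear])
      (intro continuous_intros)
  then have "continuous_on S f"
    unfolding f_def by (intro continuous_on_diff continuous_on_const)
  then have "continuous_on S F"
    unfolding F_def using f_range by (intro continuous_on_vec_lambda continuous_on_arcsin
        continuous_on_component) auto
  \<comment> \<open>\<open>arcsin\<close> is monotone and undoes \<open>sin\<close> at
    \<open>t\<close> and \<open>- t\<close>, as \<open>t\<close> is below pi/2.\<close>
  moreover have "F \<in> S \<rightarrow> S"
  proof
    fix \<psi> assume "\<psi> \<in> S"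
    have "\<bar>arcsin (f \<psi> $ e)\<bar> \<le> t" for e
    proof -
      have "- sin t \<le> f \<psi> $ e" "f \<psi> $ e \<le> sin t"
        using f_bound[OF \<open>\<psi> \<in> S\<close>, of e] by auto
      then have "arcsin (sin (- t)) \<le> arcsin (f \<psi> $ e)" "arcsin (f \<psi> $ e) \<le> arcsin (sin t)"
        using f_range[OF \<open>\<psi> \<in> S\<close>, of e] by (auto intro!: arcsin_le_arcsin)
      then show ?thesis
        using t arcsin_sin[of t] arcsin_sin[of "- t"] by auto
    qed
    then show "F \<psi> \<in> S"
      by (simp add: S infnorm_le_iff_cart F_def)
  qed
  moreover have "0 \<in> S"
    using t by (simp add: S infnorm_0)
  moreover have "compact S" "convex S"
    by (simp_all add: S_def)
  ultimately obtain \<psi> where \<psi>: "\<psi> \<in> S" "F \<psi> = \<psi>"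
    by (metis brouwer empty_iff)
  \<comment> \<open>Taking sines of the fixed point equation recovers the branch equation.\<close>
  then have "sin (\<psi> $ e) = f \<psi> $ e" for e
    using f_range by (metis F_def sin_arcsin vec_lambda_beta)
  then show ?thesis
    using \<psi>(1) S by (auto simp: branch_solution_def f_def vec_eq_iff)
qed

text \<open>The assumption \<open>contr\<close> is rho tan t < 1 without the division; it makes the
  difference of the sine vectors strictly contract, so that difference vanishes.\<close>

lemma branch_solution_unique:
  assumes t: "t < pi / 2"
    and contr: "matrix_infnorm M * sin t < cos t"
    and \<psi>: "branch_solution M p \<psi>" "infnorm \<psi> \<le> t"
    and \<psi>': "branch_solution M p \<psi>'" "infnorm \<psi>' \<le> t"
  shows "\<psi> = \<psi>'"
proof -
  define s where "s = (\<chi> e. sin (\<psi> $ e) - sin (\<psi>' $ e))"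
  define c where "c = (\<chi> e. cos (\<psi> $ e) - cos (\<psi>' $ e))"
  have "0 \<le> t"
    using \<psi>(2) infnorm_pos_le order_trans by blast
  then have ct: "0 < cos t" and st: "0 \<le> sin t"
    using t by (auto intro: cos_gt_zero_pi sin_ge_zero)
  have "s = M *v c"
  proof -
    have "s = (\<chi> e. sin (\<psi> $ e)) - (\<chi> e. sin (\<psi>' $ e))"
      by (simp add: s_def vec_eq_iff)
    also have "\<dots> = M *v ((\<chi> e. 1 - cos (\<psi>' $ e)) - (\<chi> e. 1 - cos (\<psi> $ e)))"
      using \<psi>(1) \<psi>'(1) by (simp add: branch_solution_def matrix_vector_mult_diff_distrib)
    also have "(\<chi> e. 1 - cos (\<psi>' $ e)) - (\<chi> e. 1 - cos (\<psi> $ e)) = c"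
      by (simp add: c_def vec_eq_iff)
    finally show ?thesis .
  qed
  have "\<bar>c $ e\<bar> \<le> sin t * infnorm s / cos t" for e
  proof -
    have "\<bar>c $ e\<bar> * cos t \<le> sin t * \<bar>s $ e\<bar>"
      using \<psi>(2) \<psi>'(2) t by (simp add: c_def s_def infnorm_le_iff_cart abs_cos_diff_le)
    also have "\<dots> \<le> sin t * infnorm s"
      by (intro mult_left_mono component_le_infnorm_cart st)
    finally show ?thesis
      using ct by (simp add: pos_le_divide_eq)
  qed
  then have "infnorm s \<le> matrix_infnorm M * (sin t * infnorm s / cos t)"
    unfolding infnorm_le_iff_cart[of s] by (metis \<open>s = M *v c\<close> matrix_infnorm_mult_bound)
  then have "infnorm s * cos t \<le> (matrix_infnorm M * sin t) * infnorm s"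
    using ct by (simp add: field_simps)
  then have "infnorm s = 0"
    using contr infnorm_pos_le[of s] by (smt (verit) mult.commute mult_strict_left_mono)
  then have "sin (\<psi> $ e) = sin (\<psi>' $ e)" for e
    by (simp add: infnorm_eq_0 s_def vec_eq_iff)
  moreover have "\<bar>\<psi> $ e\<bar> \<le> pi / 2" "\<bar>\<psi>' $ e\<bar> \<le> pi / 2" for e
    using \<psi>(2) \<psi>'(2) t by (meson infnorm_le_iff_cart less_imp_le order_trans)+
  ultimately show ?thesis
    unfolding vec_eq_iff abs_le_iff by (metis minus_le_iff sin_inj_pi)
qed

text \<open>Carries unique existence from phase differences back to bus angles along a linear
  bijection.\<close>

lemma transpose_mult_ex1:
  fixes A :: "real ^ 'e ^ 'n"
  assumes "A ** B = mat 1" "B ** A = mat 1" and "\<exists>!\<psi>. Q \<psi>"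
  shows "\<exists>!\<theta>. Q (transpose A *v \<theta>)"
proof -
  have 1: "transpose A *v (transpose B *v x) = x" for x
    using assms(2) by (simp add: matrix_vector_mul_assoc matrix_transpose_mul[symmetric]
        del: transpose_matrix_vector)
  have 2: "transpose B *v (transpose A *v x) = x" for x
    using assms(1) by (simp add: matrix_vector_mul_assoc matrix_transpose_mul[symmetric]
        del: transpose_matrix_vector)
  show ?thesis
    using assms(3) 1 2 by metis
qed

section \<open>The quadratic behind the two thresholds\<close>

text \<open>
  \<open>\<beta>\<^sub>m\<close> and \<open>\<beta>\<^sub>p\<close> are the roots of \<open>(c - \<beta>)\<^sup>2 = \<rho>\<^sup>2 (1 - \<beta>\<^sup>2)\<close> with \<open>c = \<Gamma> + \<rho>\<close>, which is the squared form
  of \<open>\<beta> = \<Gamma> + \<rho> (1 - sqrt (1 - \<beta>\<^sup>2))\<close>; their quarter discriminant is \<open>\<rho>\<^sup>2 s\<^sup>2\<close>, where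
  \<open>c\<^sup>2 + s\<^sup>2 = 1 + \<rho>\<^sup>2\<close>.
\<close>

lemma beta_properties:
  fixes \<Gamma> \<rho> :: real
  assumes nonneg: "0 \<le> \<Gamma>" "0 \<le> \<rho>" and cond: "\<Gamma>\<^sup>2 + 2 * \<Gamma> * \<rho> < 1"
  defines "s \<equiv> sqrt (1 - (\<Gamma>\<^sup>2 + 2 * \<Gamma> * \<rho>))"
  defines "\<beta>\<^sub>m \<equiv> (\<Gamma> + \<rho>) / (1 + \<rho>\<^sup>2) - \<rho> / (1 + \<rho>\<^sup>2) * s"
    and "\<beta>\<^sub>p \<equiv> (\<Gamma> + \<rho>) / (1 + \<rho>\<^sup>2) + \<rho> / (1 + \<rho>\<^sup>2) * s"
  shows "0 \<le> \<beta>\<^sub>m" "\<beta>\<^sub>m \<le> \<beta>\<^sub>p" "\<beta>\<^sub>p \<le> 1" "0 < \<rho> \<Longrightarrow> \<beta>\<^sub>m < \<beta>\<^sub>p" "\<beta>\<^sub>m < 1"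
    and "\<Gamma> + \<rho> * (1 - sqrt (1 - \<beta>\<^sub>m\<^sup>2)) = \<beta>\<^sub>m"
    and "\<rho> * \<beta>\<^sub>m < sqrt (1 - \<beta>\<^sub>m\<^sup>2)"
    and "\<And>b. \<beta>\<^sub>m < b \<Longrightarrow> b < \<beta>\<^sub>p \<Longrightarrow> \<Gamma> + \<rho> * (1 - sqrt (1 - b\<^sup>2)) < b"
proof -
  define c where "c = \<Gamma> + \<rho>"
  define d where "d = 1 + \<rho>\<^sup>2"
  have d: "0 < d"
    by (simp add: d_def add_pos_nonneg)
  have s: "0 < s" and s2: "s\<^sup>2 = 1 - (\<Gamma>\<^sup>2 + 2 * \<Gamma> * \<rho>)"
    using cond by (simp_all add: s_def)
  have cs: "c\<^sup>2 + s\<^sup>2 = d"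
    unfolding s2 by (simp add: c_def d_def power2_eq_square algebra_simps)
  \<comment> \<open>Working with multiples of \<open>d > 0\<close> keeps the estimates free of
    fractions.\<close>
  have m: "\<beta>\<^sub>m * d = c - \<rho> * s" and p: "\<beta>\<^sub>p * d = c + \<rho> * s"
    using d by (simp_all add: \<beta>\<^sub>m_def \<beta>\<^sub>p_def c_def[symmetric] d_def[symmetric] field_simps)
  have "s\<^sup>2 \<le> 1"
    unfolding s2 using nonneg mult_nonneg_nonneg[of "2 * \<Gamma>" \<rho>] by (smt (verit) zero_le_power2)
  then have "s \<le> 1"
    using s by (simp add: power_le_one_iff)
  then have rs: "\<rho> * s \<le> \<rho>"
    using nonneg by (simp add: mult_left_le)
  then have "0 \<le> \<beta>\<^sub>m * d"
    using nonneg rs by (simp add: m c_def)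
  then show m0: "0 \<le> \<beta>\<^sub>m"
    using d by (simp add: zero_le_mult_iff)
  have "\<beta>\<^sub>m * d \<le> \<beta>\<^sub>p * d"
    using s nonneg by (simp add: m p)
  then show mp: "\<beta>\<^sub>m \<le> \<beta>\<^sub>p"
    using d by simp
  \<comment> \<open>Lagrange identity for the vectors (c, s) and (1, rho); dropping the second
    square is Cauchy-Schwarz and bounds the larger root by 1.\<close>
  have "(c + \<rho> * s)\<^sup>2 + (\<rho> * c - s)\<^sup>2 = (c\<^sup>2 + s\<^sup>2) * d"
    by (simp add: d_def power2_eq_square algebra_simps)
  also have "\<dots> = d\<^sup>2"
    unfolding cs by (simp add: power2_eq_square)
  finally have "(c + \<rho> * s)\<^sup>2 \<le> d\<^sup>2"
    using zero_le_power2[of "\<rho> * c - s"] by linarith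
  then have "c + \<rho> * s \<le> d"
    by (rule power2_le_imp_le) (use d in simp)
  then have "\<beta>\<^sub>p * d \<le> 1 * d"
    by (simp add: p)
  then show p1: "\<beta>\<^sub>p \<le> 1"
    using d by (rule mult_right_le_imp_le)
  show mp_strict: "\<beta>\<^sub>m < \<beta>\<^sub>p" if "0 < \<rho>"
  proof -
    have "\<beta>\<^sub>m * d < \<beta>\<^sub>p * d"
      using that s by (simp add: m p)
    then show ?thesis
      using d by simp
  qed
  show m1: "\<beta>\<^sub>m < 1"
  \<comment> \<open>For \<open>\<rho> = 0\<close> the root is \<open>\<Gamma>\<close> itself, which
    \<open>cond\<close> keeps below 1; otherwise it lies strictly below
    \<open>\<beta>\<^sub>p\<close>.\<close>
  proof (cases "\<rho> = 0")
    case True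
    then have "\<Gamma>\<^sup>2 < 1"
      using cond by simp
    then show ?thesis
      using True nonneg by (simp add: \<beta>\<^sub>m_def power_less_one_iff abs_square_less_1)
  next
    case False
    then show ?thesis
      using mp_strict p1 nonneg by simp
  qed
  have factor: "d * ((c - b)\<^sup>2 - \<rho>\<^sup>2 * (1 - b\<^sup>2)) = (d * b - (c - \<rho> * s)) * (d * b - (c + \<rho> * s))" for b
  proof -
    have "d * ((c - b)\<^sup>2 - \<rho>\<^sup>2 * (1 - b\<^sup>2)) = d * (d * b\<^sup>2 - 2 * c * b + c\<^sup>2 - \<rho>\<^sup>2)"
      by (simp add: d_def power2_eq_square algebra_simps)
    also have "\<dots> = (d * b - c)\<^sup>2 - \<rho>\<^sup>2 * (d - c\<^sup>2)"
      by (simp add: d_def power2_eq_square algebra_simps)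
    also have "\<dots> = (d * b - c)\<^sup>2 - \<rho>\<^sup>2 * s\<^sup>2"
      using cs by (metis add_diff_cancel_left')
    also have "\<dots> = (d * b - (c - \<rho> * s)) * (d * b - (c + \<rho> * s))"
      by (simp add: power2_eq_square algebra_simps)
    finally show ?thesis .
  qed
  have m_sq: "\<beta>\<^sub>m\<^sup>2 < 1"
    using m0 m1 by (simp add: abs_square_less_1)
  have "d * ((c - \<beta>\<^sub>m)\<^sup>2 - \<rho>\<^sup>2 * (1 - \<beta>\<^sub>m\<^sup>2)) = 0"
    unfolding factor using m by (simp add: mult.commute)
  then have "(c - \<beta>\<^sub>m)\<^sup>2 = (\<rho> * sqrt (1 - \<beta>\<^sub>m\<^sup>2))\<^sup>2"
    using d m_sq by (simp add: power_mult_distrib)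
  \<comment> \<open>This form shows \<open>c - \<beta>\<^sub>m\<close> to be nonnegative, which
    fixes the sign when the squares are removed. Divided by \<open>\<rho>\<close>, it also yields
    the contraction inequality, with margin \<open>s\<close>.\<close>
  moreover have cm: "c - \<beta>\<^sub>m = \<rho>\<^sup>2 * \<beta>\<^sub>m + \<rho> * s"
    using m by (simp add: d_def algebra_simps)
  ultimately have root: "c - \<beta>\<^sub>m = \<rho> * sqrt (1 - \<beta>\<^sub>m\<^sup>2)"
    using m0 nonneg s m_sq by (simp add: power2_eq_iff_nonneg)
  then show "\<Gamma> + \<rho> * (1 - sqrt (1 - \<beta>\<^sub>m\<^sup>2)) = \<beta>\<^sub>m"
    by (simp add: c_def algebra_simps)
  show "\<rho> * \<beta>\<^sub>m < sqrt (1 - \<beta>\<^sub>m\<^sup>2)"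
  proof (cases "\<rho> = 0")
    case True
    then show ?thesis
      using m_sq by simp
  next
    case False
    have "\<rho> * sqrt (1 - \<beta>\<^sub>m\<^sup>2) = \<rho> * (\<rho> * \<beta>\<^sub>m + s)"
      using root cm by (simp add: power2_eq_square algebra_simps)
    then show ?thesis
      using False s by simp
  qed
  show "\<Gamma> + \<rho> * (1 - sqrt (1 - b\<^sup>2)) < b" if b: "\<beta>\<^sub>m < b" "b < \<beta>\<^sub>p" for b
  proof -
    have "0 \<le> b" "b < 1"
      using b m0 p1 by auto
    then have b_sq: "b\<^sup>2 < 1"
      by (simp add: abs_square_less_1)
    have "c - \<rho> * s < d * b" "d * b < c + \<rho> * s"
      using b d by (simp_all add: m[symmetric] p[symmetric] mult.commute)
    \<comment> \<open>Strictly between its roots the quadratic is negative.\<close>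
    then have "d * ((c - b)\<^sup>2 - \<rho>\<^sup>2 * (1 - b\<^sup>2)) < 0"
      unfolding factor by (intro mult_pos_neg) auto
    then have "(c - b)\<^sup>2 < (\<rho> * sqrt (1 - b\<^sup>2))\<^sup>2"
      using d b_sq by (simp add: mult_less_0_iff power_mult_distrib)
    then have "c - b < \<rho> * sqrt (1 - b\<^sup>2)"
      using nonneg b_sq by (meson less_eq_real_def mult_nonneg_nonneg power2_less_imp_less
          real_sqrt_ge_zero diff_ge_0_iff_ge)
    then show ?thesis
      by (simp add: c_def algebra_simps)
  qed
qed

section \<open>Strictness of the thresholds and assembly\<close>

text \<open>Multiplying by \<open>A ** D\<close> recovers the unsigned incidence matrix times the
  diagonal conductance matrix. Each branch has a non-slack end, and the row of that bus exposes the
  branch's entry.\<close>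

lemma branch_matrix_eq_0D:
  fixes src snk :: "'e::finite \<Rightarrow> 'n::finite option"
  assumes A: "A ** A' = mat 1" and D: "D ** D' = mat 1"
    and zero: "D' ** A' ** unsigned_reduced_incidence src snk ** branch_G src snk Y V = 0"
    and V: "\<And>i. V $ i \<noteq> 0" and loop: "\<And>e. src e \<noteq> snk e"
  shows "conductance Y $ src e $ snk e = 0"
proof -
  define U where "U = unsigned_reduced_incidence src snk"
  define G where "G = branch_G src snk Y V"
  have "A ** D ** (D' ** A' ** U ** G) = A ** (D ** D') ** A' ** U ** G"
    by (simp add: matrix_mul_assoc)
  also have "\<dots> = U ** G"
    by (simp add: A D)
  finally have UG: "U ** G = 0"
    using zero by (simp add: U_def G_def)
  obtain k where "src e = Some k \<or> snk e = Some k"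
    using loop[of e] by (cases "src e"; cases "snk e") auto
  then have "U $ k $ e = 1"
    using loop[of e] by (auto simp: U_def unsigned_reduced_incidence_def reduced_incidence_def
        incidence_def)
  have "0 = (\<Sum>f\<in>UNIV. U $ k $ f * G $ f $ e)"
    using UG by (simp add: matrix_matrix_mult_def vec_eq_iff)
  also have "\<dots> = (\<Sum>f\<in>UNIV. if f = e then U $ k $ e * G $ e $ e else 0)"
    by (intro sum.cong) (auto simp: G_def branch_G_def)
  also have "\<dots> = G $ e $ e"
    using \<open>U $ k $ e = 1\<close> by simp
  finally show ?thesis
    using V by (simp add: G_def branch_G_def)
qed

text \<open>In the lossless case \<open>\<rho> = 0\<close> both thresholds equal
  \<open>\<Gamma>\<close>, so strictness is claimed only with some nonzero branch conductance. The
  gap is stated for the largest phase difference and for all branches simultaneously.\<close>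

theorem mainTheorem3:
  fixes src snk :: "'e::finite \<Rightarrow> 'n::finite option"
    and Y :: "complex ^ ('n option) ^ ('n option)"
    and V :: "real ^ ('n option)"
    and v :: real
    and P :: "real ^ 'n"
    and A\<^sub>r :: "real ^ 'e ^ 'n"
    and \<psi>\<^sub>M\<^sub>D\<^sub>C :: "real ^ 'e"
    and \<rho> \<Gamma> \<beta>\<^sub>m \<beta>\<^sub>p :: real
  assumes radial: "radial_network src snk"
    and taps: "no_off_nominal_taps src snk Y"
    and voltages: "v > 0" "\<forall>i. V $ i = v"
    and A\<^sub>r: "A\<^sub>r = reduced_incidence src snk"
    and \<rho>: "\<rho> = matrix_infnorm (matrix_inv (branch_B src snk Y V) ** matrix_inv A\<^sub>r **
                  unsigned_reduced_incidence src snk ** branch_G src snk Y V)"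
    and \<psi>\<^sub>M\<^sub>D\<^sub>C: "\<psi>\<^sub>M\<^sub>D\<^sub>C = transpose A\<^sub>r *v (matrix_inv (laplacian_B src snk Y V) *v P)"
    and \<Gamma>: "\<Gamma> = infnorm \<psi>\<^sub>M\<^sub>D\<^sub>C"
    and \<beta>\<^sub>m: "\<beta>\<^sub>m = (\<Gamma> + \<rho>) / (1 + \<rho>\<^sup>2) - \<rho> / (1 + \<rho>\<^sup>2) * sqrt (1 - (\<Gamma>\<^sup>2 + 2 * \<Gamma> * \<rho>))"
    and \<beta>\<^sub>p: "\<beta>\<^sub>p = (\<Gamma> + \<rho>) / (1 + \<rho>\<^sup>2) + \<rho> / (1 + \<rho>\<^sup>2) * sqrt (1 - (\<Gamma>\<^sup>2 + 2 * \<Gamma> * \<rho>))"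
    and cond: "\<Gamma>\<^sup>2 + 2 * \<Gamma> * \<rho> < 1"
  shows "0 \<le> \<beta>\<^sub>m \<and> \<beta>\<^sub>m \<le> \<beta>\<^sub>p \<and> \<beta>\<^sub>p \<le> 1 \<and>
    ((\<exists>e. conductance Y $ src e $ snk e \<noteq> 0) \<longrightarrow> \<beta>\<^sub>m < \<beta>\<^sub>p) \<and>
    arcsin \<beta>\<^sub>m < pi / 2 \<and>
    (\<exists>!\<theta> :: real ^ 'n. active_power_flow Y V P \<theta> \<and>
        infnorm (transpose A\<^sub>r *v \<theta>) \<le> arcsin \<beta>\<^sub>m) \<and>
    \<not> (\<exists>\<theta> :: real ^ 'n. active_power_flow Y V P \<theta> \<and>
        arcsin \<beta>\<^sub>m < infnorm (transpose A\<^sub>r *v \<theta>) \<and>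
        infnorm (transpose A\<^sub>r *v \<theta>) < arcsin \<beta>\<^sub>p) \<and>
    \<not> (\<exists>\<theta> :: real ^ 'n. active_power_flow Y V P \<theta> \<and>
        (\<forall>e. arcsin \<beta>\<^sub>m < \<bar>bus_angle \<theta> (src e) - bus_angle \<theta> (snk e)\<bar> \<and>
             \<bar>bus_angle \<theta> (src e) - bus_angle \<theta> (snk e)\<bar> < arcsin \<beta>\<^sub>p))"
proof -
  define M where "M = matrix_inv (branch_B src snk Y V) ** matrix_inv A\<^sub>r **
    unsigned_reduced_incidence src snk ** branch_G src snk Y V"
  have loop: "src e \<noteq> snk e" for e
    using radial by (simp add: radial_network_def simple_network_def)
  have flow: "active_power_flow Y V P \<theta> \<longleftrightarrow> branch_solution M \<psi>\<^sub>M\<^sub>D\<^sub>C (transpose A\<^sub>r *v \<theta>)" for \<theta>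
    unfolding branch_solution_def M_def A\<^sub>r \<psi>\<^sub>M\<^sub>D\<^sub>C
    using voltages by (intro active_power_flow_iff_branch[OF radial taps]) auto
  have \<rho>_M: "\<rho> = matrix_infnorm M"
    by (simp add: \<rho> M_def)
  have nonneg: "0 \<le> \<Gamma>" "0 \<le> \<rho>"
    by (simp_all add: \<Gamma> \<rho>_M infnorm_pos_le matrix_infnorm_nonneg)
  note \<beta> = beta_properties[OF nonneg cond, folded \<beta>\<^sub>m \<beta>\<^sub>p]
  note A = reduced_incidence_inverse[OF radial, folded A\<^sub>r]
  define t where "t = arcsin \<beta>\<^sub>m"
  have sin_t: "sin t = \<beta>\<^sub>m" and cos_t: "cos t = sqrt (1 - \<beta>\<^sub>m\<^sup>2)"
    using \<beta>(1,5) by (simp_all add: t_def cos_arcsin)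
  have "0 \<le> t"
    using \<beta>(1,5) arcsin_le_arcsin[of 0 \<beta>\<^sub>m] by (simp add: t_def)
  have "t < pi / 2"
    using \<beta>(1,5) arcsin_less_arcsin[of \<beta>\<^sub>m 1] by (simp add: t_def)
  have strict: "\<beta>\<^sub>m < \<beta>\<^sub>p" if "conductance Y $ src e $ snk e \<noteq> 0" for e
  proof -
    have "M \<noteq> 0"
    proof
      assume "M = 0"
      have "branch_B src snk Y V ** matrix_inv (branch_B src snk Y V) = mat 1"
        using branch_B_inverse[OF taps] voltages by simp
      then have "conductance Y $ src e $ snk e = 0"
        using \<open>M = 0\<close> voltages loop by (intro branch_matrix_eq_0D[OF A(1)]) (auto simp: M_def)
      with that show False ..
    qed
    then show ?thesis
      using \<beta>(4) nonneg(2) matrix_infnorm_eq_0D \<rho>_M by fastforce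
  qed
  \<comment> \<open>At radius \<open>t\<close> the invariance bound for Brouwer holds with equality,
    by the root equation for \<open>\<beta>\<^sub>m\<close>.\<close>
  have "\<exists>!\<psi>. branch_solution M \<psi>\<^sub>M\<^sub>D\<^sub>C \<psi> \<and> infnorm \<psi> \<le> t"
  proof (rule ex_ex1I)
    show "\<exists>\<psi>. branch_solution M \<psi>\<^sub>M\<^sub>D\<^sub>C \<psi> \<and> infnorm \<psi> \<le> t"
      using \<open>0 \<le> t\<close> \<open>t < pi / 2\<close> \<beta>(6)
      by (intro branch_solution_exists) (simp_all add: sin_t cos_t \<Gamma> \<rho>_M)
    show "\<psi> = \<psi>'" if "branch_solution M \<psi>\<^sub>M\<^sub>D\<^sub>C \<psi> \<and> infnorm \<psi> \<le> t"
      "branch_solution M \<psi>\<^sub>M\<^sub>D\<^sub>C \<psi>' \<and> infnorm \<psi>' \<le> t" for \<psi> \<psi>'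
      using that \<beta>(7) \<open>t < pi / 2\<close>
      by (intro branch_solution_unique[of t M \<psi>\<^sub>M\<^sub>D\<^sub>C]) (simp_all add: sin_t cos_t \<rho>_M)
  qed
  then have ex1: "\<exists>!\<theta>. active_power_flow Y V P \<theta> \<and> infnorm (transpose A\<^sub>r *v \<theta>) \<le> t"
    unfolding flow by (rule transpose_mult_ex1[OF A])
  have no_sol: False if sol: "active_power_flow Y V P \<theta>"
    and low: "t < infnorm (transpose A\<^sub>r *v \<theta>)" and up: "infnorm (transpose A\<^sub>r *v \<theta>) < arcsin \<beta>\<^sub>p"
  for \<theta>
  proof -
    define r where "r = infnorm (transpose A\<^sub>r *v \<theta>)"
    have \<beta>\<^sub>p_range: "- 1 \<le> \<beta>\<^sub>p" "\<beta>\<^sub>p \<le> 1"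
      using \<beta>(1-3) by auto
    have r: "t < r" "r < arcsin \<beta>\<^sub>p" "0 \<le> r" "r < pi / 2"
      using low up \<open>0 \<le> t\<close> arcsin_ubound[OF \<beta>\<^sub>p_range] by (auto simp: r_def)
    \<comment> \<open>All angles involved lie in [0, pi/2], so comparing them is comparing their
      sines.\<close>
    have "sin t < sin r" "sin r < sin (arcsin \<beta>\<^sub>p)"
      using r \<open>0 \<le> t\<close> arcsin_ubound[OF \<beta>\<^sub>p_range] by (auto intro!: sin_monotone_2pi)
    then have "\<beta>\<^sub>m < sin r" "sin r < \<beta>\<^sub>p"
      using \<beta>\<^sub>p_range by (simp_all add: sin_t)
    then have "\<Gamma> + \<rho> * (1 - sqrt (1 - (sin r)\<^sup>2)) < sin r"
      by (rule \<beta>(8))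
    moreover have "cos r = sqrt (1 - (sin r)\<^sup>2)"
      using r cos_ge_zero[of r] by (simp add: cos_squared_eq[symmetric])
    moreover have "sin r \<le> \<Gamma> + \<rho> * (1 - cos r)"
      using branch_solution_sin_bound[OF sol[unfolded flow]] r(4) by (simp add: r_def \<Gamma> \<rho>_M)
    ultimately show False
      by simp
  qed
  moreover have False if "active_power_flow Y V P \<theta>"
    and all: "\<And>e. t < \<bar>bus_angle \<theta> (src e) - bus_angle \<theta> (snk e)\<bar> \<and>
      \<bar>bus_angle \<theta> (src e) - bus_angle \<theta> (snk e)\<bar> < arcsin \<beta>\<^sub>p" for \<theta>
  proof -
    \<comment> \<open>If every branch lies in the gap, so does the one attaining the norm.\<close>
    obtain e where "infnorm (transpose A\<^sub>r *v \<theta>) = \<bar>(transpose A\<^sub>r *v \<theta>) $ e\<bar>"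
      by (rule infnorm_attained_cart)
    also have "\<dots> = \<bar>bus_angle \<theta> (src e) - bus_angle \<theta> (snk e)\<bar>"
      unfolding A\<^sub>r using reduced_incidence_transpose_component[of src e snk \<theta>] loop by metis
    finally show False
      using no_sol that(1) all[of e] by metis
  qed
  ultimately show ?thesis
    using \<beta>(1-3) strict \<open>t < pi / 2\<close> ex1 unfolding t_def by blast
qed

end
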